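(* Let $(X,d_X)$ be a metric space. Any two idempotents in the semigroup $M(X)$ commute: if $a,b\in M(X)$, $a^2=a$ and $b^2=b$, then $ab=ba$.
   Context: Let $(X,d_X)$ be a metric space. Write $x$ for $(x,0)$ and $x'$ for $(x,1)$ in $X\times\{0,1\}$. $\mathcal M(X)$ is the set of all metrics $d$ on $X\times\{0,1\}$ (metrics on the double of $X$) whose restriction to each of the two copies of $X$ equals $d_X$ and for which $\inf_{x,y\in X}d(x,y')>0$. Equivalence: $d_1\sim d_2$ if there exist $\alpha>0$, $\beta\ge 1$ with $-\alpha+\frac1\beta d_1(x,y')\le d_2(x,y')\le\alpha+\beta d_1(x,y')$ for all $x,y\in X$. $[d]$ is the class of $d$ and $M(X)=\mathcal M(X)/\sim$. Composition: for $\rho,d\in\mathcal M(X)$, $\rho d\in\mathcal M(X)$ is given by $\rho d(x,z')=\inf_{y\in X}[d(x,y')+\rho(y,z')]$. It is associative and respects $\sim$, so $M(X)$ is a semigroup with $[\rho][d]=[\rho d]$. *)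

theory Defs
  imports "HOL-Analysis.Analysis"
begin

text \<open>
  The metric space \<open>X\<close> is a type \<open>'a\<close> of class \<^class>\<open>metric_space\<close> with its metric \<^const>\<open>dist\<close>.
  Its double is \<^typ>\<open>'a \<times> bool\<close>: \<open>(x, False)\<close> is the point $x$ of the first copy and
  \<open>(x, True)\<close> the point $x'$ of the second copy.
\<close>

definition double_metrics :: "('a::metric_space \<times> bool \<Rightarrow> 'a \<times> bool \<Rightarrow> real) set" where
  "double_metrics = {d. Metric_space UNIV d
      \<and> (\<forall>i x y. d (x, i) (y, i) = dist x y)
      \<and> (INF (x, y)\<in>UNIV. d (x, False) (y, True)) > 0}"

lemma double_metrics_iff:
  "d \<in> double_metrics \<longleftrightarrow> Metric_space UNIV d
      \<and> (\<forall>i x y. d (x, i) (y, i) = dist x y)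
      \<and> (\<exists>c>0. \<forall>x y. c \<le> d (x, False) (y, True))"
proof -
  have "(INF (x, y)\<in>UNIV. d (x, False) (y, True)) > 0
      \<longleftrightarrow> (\<exists>c>0. \<forall>x y. c \<le> d (x, False) (y, True))" if "Metric_space UNIV d"
  proof
    assume pos: "(INF (x, y)\<in>UNIV. d (x, False) (y, True)) > 0"
    have bdd: "bdd_below (range (\<lambda>(x, y). d (x, False) (y, True)))"
      using Metric_space.nonneg[OF that] by (intro bdd_belowI[where m = 0]) auto
    have "(INF (x, y)\<in>UNIV. d (x, False) (y, True)) \<le> d (x, False) (y, True)" for x y
      using cINF_lower[OF bdd, of "(x, y)"] by simp
    with pos show "\<exists>c>0. \<forall>x y. c \<le> d (x, False) (y, True)" by blast
  next
    assume "\<exists>c>0. \<forall>x y. c \<le> d (x, False) (y, True)"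
    then obtain c where c: "c > 0" "\<And>x y. c \<le> d (x, False) (y, True)" by blast
    have "c \<le> (INF (x, y)\<in>UNIV. d (x, False) (y, True))"
      using c(2) by (intro cINF_greatest) auto
    with c(1) show "(INF (x, y)\<in>UNIV. d (x, False) (y, True)) > 0" by linarith
  qed
  then show ?thesis by (auto simp: double_metrics_def)
qed

typedef (overloaded) 'a double_metric =
  "double_metrics :: ('a::metric_space \<times> bool \<Rightarrow> 'a \<times> bool \<Rightarrow> real) set"
  morphisms dmetric Abs_double_metric
proof
  let ?d = "\<lambda>p q :: 'a \<times> bool. dist (fst p) (fst q) + (if snd p = snd q then 0 else 1)"
  have "Metric_space UNIV ?d"
  proof
    show "?d p r \<le> ?d p q + ?d q r" for p q r
      using dist_triangle[of "fst p" "fst r" "fst q"] by auto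
    show "?d p q = 0 \<longleftrightarrow> p = q" for p q
      by (auto simp: prod_eq_iff add_nonneg_eq_0_iff)
  qed (auto simp: dist_commute)
  then show "?d \<in> double_metrics"
    by (auto simp: double_metrics_iff intro!: exI[of _ 1])
qed

setup_lifting type_definition_double_metric

lemma dmetric_Metric_space: "Metric_space UNIV (dmetric d)"
  and dmetric_same [simp]: "dmetric d (x, i) (y, i) = dist x y"
  and dmetric_cross_bound: "\<exists>c>0. \<forall>x y. c \<le> dmetric d (x, False) (y, True)"
  using dmetric[of d] by (auto simp: double_metrics_iff)

lemma dmetric_nonneg [simp]: "0 \<le> dmetric d p q"
  using Metric_space.nonneg[OF dmetric_Metric_space] .

lemma dmetric_commute: "dmetric d p q = dmetric d q p"
  using Metric_space.commute[OF dmetric_Metric_space] .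

lemma dmetric_triangle: "dmetric d p r \<le> dmetric d p q + dmetric d q r"
  using Metric_space.triangle[OF dmetric_Metric_space] by simp

definition dm_equiv :: "'a::metric_space double_metric \<Rightarrow> 'a double_metric \<Rightarrow> bool" where
  "dm_equiv d1 d2 \<longleftrightarrow> (\<exists>\<alpha>>0. \<exists>\<beta>\<ge>1. \<forall>x y.
      - \<alpha> + 1 / \<beta> * dmetric d1 (x, False) (y, True) \<le> dmetric d2 (x, False) (y, True) \<and>
      dmetric d2 (x, False) (y, True) \<le> \<alpha> + \<beta> * dmetric d1 (x, False) (y, True))"

definition dm_dominated :: "'a::metric_space double_metric \<Rightarrow> 'a double_metric \<Rightarrow> bool" where
  "dm_dominated d1 d2 \<longleftrightarrow> (\<exists>\<alpha>>0. \<exists>\<beta>\<ge>1. \<forall>x y.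
      dmetric d1 (x, False) (y, True) \<le> \<alpha> + \<beta> * dmetric d2 (x, False) (y, True))"

lemma dm_equiv_iff_dominated: "dm_equiv d1 d2 \<longleftrightarrow> dm_dominated d1 d2 \<and> dm_dominated d2 d1"
proof
  assume "dm_equiv d1 d2"
  then obtain \<alpha> \<beta> where ab: "\<alpha> > 0" "\<beta> \<ge> 1"
    and *: "\<And>x y. - \<alpha> + 1 / \<beta> * dmetric d1 (x, False) (y, True) \<le> dmetric d2 (x, False) (y, True)"
      "\<And>x y. dmetric d2 (x, False) (y, True) \<le> \<alpha> + \<beta> * dmetric d1 (x, False) (y, True)"
    unfolding dm_equiv_def by blast
  have "dmetric d1 (x, False) (y, True) \<le> \<beta> * \<alpha> + \<beta> * dmetric d2 (x, False) (y, True)" for x y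
    using *(1)[of x y] ab by (simp add: field_simps)
  moreover have "\<beta> * \<alpha> > 0" using ab by simp
  ultimately show "dm_dominated d1 d2 \<and> dm_dominated d2 d1"
    unfolding dm_dominated_def using ab *(2) by blast
next
  assume "dm_dominated d1 d2 \<and> dm_dominated d2 d1"
  then obtain \<alpha> \<beta> \<alpha>' \<beta>' where ab: "\<alpha> > 0" "\<beta> \<ge> 1" "\<alpha>' > 0" "\<beta>' \<ge> 1"
    and *: "\<And>x y. dmetric d1 (x, False) (y, True) \<le> \<alpha> + \<beta> * dmetric d2 (x, False) (y, True)"
      "\<And>x y. dmetric d2 (x, False) (y, True) \<le> \<alpha>' + \<beta>' * dmetric d1 (x, False) (y, True)"
    unfolding dm_dominated_def by metis
  define A where "A = max \<alpha> \<alpha>'"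
  define B where "B = max \<beta> \<beta>'"
  have AB: "A > 0" "B \<ge> 1" using ab by (auto simp: A_def B_def)
  have "dmetric d2 (x, False) (y, True) \<le> A + B * dmetric d1 (x, False) (y, True)" for x y
    using *(2)[of x y] mult_right_mono[of \<beta>' B "dmetric d1 (x, False) (y, True)"]
    by (simp add: A_def B_def)
  moreover have "- A + 1 / B * dmetric d1 (x, False) (y, True) \<le> dmetric d2 (x, False) (y, True)" for x y
  proof -
    have "dmetric d1 (x, False) (y, True) \<le> A + B * dmetric d2 (x, False) (y, True)"
      using *(1)[of x y] mult_right_mono[of \<beta> B "dmetric d2 (x, False) (y, True)"]
      by (simp add: A_def B_def)
    also have "\<dots> \<le> B * A + B * dmetric d2 (x, False) (y, True)"
      using mult_right_mono[of 1 B A] AB by simp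
    finally show ?thesis using AB by (simp add: field_simps)
  qed
  ultimately show "dm_equiv d1 d2"
    unfolding dm_equiv_def using AB by blast
qed

lemma dm_dominated_refl: "dm_dominated d d"
  unfolding dm_dominated_def by (intro exI[of _ 1]) auto

lemma dm_dominated_trans:
  assumes "dm_dominated d1 d2" "dm_dominated d2 d3"
  shows "dm_dominated d1 d3"
proof -
  obtain \<alpha> \<beta> \<alpha>' \<beta>' where ab: "\<alpha> > 0" "\<beta> \<ge> 1" "\<alpha>' > 0" "\<beta>' \<ge> 1"
    and *: "\<And>x y. dmetric d1 (x, False) (y, True) \<le> \<alpha> + \<beta> * dmetric d2 (x, False) (y, True)"
      "\<And>x y. dmetric d2 (x, False) (y, True) \<le> \<alpha>' + \<beta>' * dmetric d3 (x, False) (y, True)"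
    using assms unfolding dm_dominated_def by metis
  have "dmetric d1 (x, False) (y, True) \<le> (\<alpha> + \<beta> * \<alpha>') + (\<beta> * \<beta>') * dmetric d3 (x, False) (y, True)" for x y
    using *(1)[of x y] mult_left_mono[OF *(2)[of x y], of \<beta>] ab by (simp add: algebra_simps)
  moreover have "\<alpha> + \<beta> * \<alpha>' > 0" using ab by (simp add: add_pos_pos)
  moreover have "\<beta> * \<beta>' \<ge> 1" using mult_mono[of 1 \<beta> 1 \<beta>'] ab by simp
  ultimately show ?thesis unfolding dm_dominated_def by blast
qed

lemma equivp_dm_equiv: "equivp dm_equiv"
  by (rule equivpI)
     (auto simp: dm_equiv_iff_dominated intro!: reflpI sympI transpI
           intro: dm_dominated_refl dm_dominated_trans)

text \<open>
  A metric on the double is determined by its values between the two copies;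
  \<open>dm_cross\<close> gives them for the composite, where \<open>dm_cross \<rho> d x z\<close> is $\rho d(x,z')$.
\<close>

definition dm_cross :: "'a::metric_space double_metric \<Rightarrow> 'a double_metric \<Rightarrow> 'a \<Rightarrow> 'a \<Rightarrow> real" where
  "dm_cross \<rho> d x z = (INF y. dmetric d (x, False) (y, True) + dmetric \<rho> (y, False) (z, True))"

fun dm_comp_fun :: "'a::metric_space double_metric \<Rightarrow> 'a double_metric
    \<Rightarrow> 'a \<times> bool \<Rightarrow> 'a \<times> bool \<Rightarrow> real" where
  "dm_comp_fun \<rho> d (x, False) (y, False) = dist x y"
| "dm_comp_fun \<rho> d (x, True) (y, True) = dist x y"
| "dm_comp_fun \<rho> d (x, False) (z, True) = dm_cross \<rho> d x z"
| "dm_comp_fun \<rho> d (z, True) (x, False) = dm_cross \<rho> d x z"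

lemma dm_cross_le: "dm_cross \<rho> d x z \<le> dmetric d (x, False) (y, True) + dmetric \<rho> (y, False) (z, True)"
  unfolding dm_cross_def
  by (rule cINF_lower) (auto intro!: bdd_belowI[where m = 0] add_nonneg_nonneg)

lemma dm_cross_greatest:
  assumes "\<And>y. c \<le> dmetric d (x, False) (y, True) + dmetric \<rho> (y, False) (z, True)"
  shows "c \<le> dm_cross \<rho> d x z"
  unfolding dm_cross_def by (rule cINF_greatest) (auto simp: assms)

lemma dm_cross_bound: "\<exists>c>0. \<forall>x z. c \<le> dm_cross \<rho> d x z"
proof -
  obtain c where c: "c > 0" "\<And>x y. c \<le> dmetric d (x, False) (y, True)"
    using dmetric_cross_bound by blast
  have "c \<le> dm_cross \<rho> d x z" for x z
    by (rule dm_cross_greatest) (metis c(2) dmetric_nonneg add_increasing2)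
  with c(1) show ?thesis by blast
qed

lemma dm_cross_pos: "0 < dm_cross \<rho> d x z"
  using dm_cross_bound[of \<rho> d] by (meson less_le_trans)

lemma dm_cross_triangle1: "dm_cross \<rho> d x z \<le> dist x u + dm_cross \<rho> d u z"
proof -
  have "dm_cross \<rho> d x z - dist x u \<le> dm_cross \<rho> d u z"
  proof (rule dm_cross_greatest)
    fix y
    show "dm_cross \<rho> d x z - dist x u \<le> dmetric d (u, False) (y, True) + dmetric \<rho> (y, False) (z, True)"
      using dm_cross_le[of \<rho> d x z y] dmetric_triangle[of d "(x, False)" "(y, True)" "(u, False)"] by simp
  qed
  then show ?thesis by simp
qed

lemma dm_cross_triangle2: "dm_cross \<rho> d x z \<le> dm_cross \<rho> d x w + dist w z"
proof -
  have "dm_cross \<rho> d x z - dist w z \<le> dm_cross \<rho> d x w"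
  proof (rule dm_cross_greatest)
    fix y
    show "dm_cross \<rho> d x z - dist w z \<le> dmetric d (x, False) (y, True) + dmetric \<rho> (y, False) (w, True)"
      using dm_cross_le[of \<rho> d x z y] dmetric_triangle[of \<rho> "(y, False)" "(z, True)" "(w, True)"] by simp
  qed
  then show ?thesis by simp
qed

lemma dm_cross_triangle3: "dist x u \<le> dm_cross \<rho> d x z + dm_cross \<rho> d u z"
proof -
  have "dist x u - dm_cross \<rho> d x z \<le> dm_cross \<rho> d u z"
  proof (rule dm_cross_greatest)
    fix v
    let ?b = "dmetric d (u, False) (v, True) + dmetric \<rho> (v, False) (z, True)"
    have "dist x u - ?b \<le> dm_cross \<rho> d x z"
    proof (rule dm_cross_greatest)
      fix y
      show "dist x u - ?b \<le> dmetric d (x, False) (y, True) + dmetric \<rho> (y, False) (z, True)"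
        using dmetric_triangle[of d "(x, False)" "(u, False)" "(y, True)"]
          dmetric_triangle[of d "(y, True)" "(u, False)" "(v, True)"]
          dmetric_triangle[of \<rho> "(y, False)" "(v, False)" "(z, True)"]
        by (simp add: dmetric_commute[of d "(v, True)"] dmetric_commute[of \<rho> "(z, True)"])
    qed
    then show "dist x u - dm_cross \<rho> d x z \<le> ?b" by simp
  qed
  then show ?thesis by simp
qed

lemma dm_cross_triangle4: "dist z w \<le> dm_cross \<rho> d x z + dm_cross \<rho> d x w"
proof -
  have "dist z w - dm_cross \<rho> d x z \<le> dm_cross \<rho> d x w"
  proof (rule dm_cross_greatest)
    fix v
    let ?b = "dmetric d (x, False) (v, True) + dmetric \<rho> (v, False) (w, True)"
    have "dist z w - ?b \<le> dm_cross \<rho> d x z"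
    proof (rule dm_cross_greatest)
      fix y
      show "dist z w - ?b \<le> dmetric d (x, False) (y, True) + dmetric \<rho> (y, False) (z, True)"
        using dmetric_triangle[of \<rho> "(z, True)" "(w, True)" "(y, False)"]
          dmetric_triangle[of \<rho> "(y, False)" "(w, True)" "(v, False)"]
          dmetric_triangle[of d "(y, True)" "(v, True)" "(x, False)"]
        by (simp add: dmetric_commute[of d "(y, True)"] dmetric_commute[of \<rho> "(z, True)"])
    qed
    then show "dist z w - dm_cross \<rho> d x z \<le> ?b" by simp
  qed
  then show ?thesis by simp
qed

lemma dm_comp_fun_in_double_metrics: "dm_comp_fun \<rho> d \<in> double_metrics"
proof -
  have "Metric_space UNIV (dm_comp_fun \<rho> d)"
  proof
    fix p q r :: "'a \<times> bool"
    obtain x i where p: "p = (x, i)" by force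
    obtain y j where q: "q = (y, j)" by force
    obtain z k where r: "r = (z, k)" by force
    show "0 \<le> dm_comp_fun \<rho> d p q"
      unfolding p q by (cases i; cases j) (auto intro: less_imp_le dm_cross_pos)
    show "dm_comp_fun \<rho> d p q = dm_comp_fun \<rho> d q p"
      unfolding p q by (cases i; cases j) (auto simp: dist_commute)
    show "dm_comp_fun \<rho> d p q = 0 \<longleftrightarrow> p = q"
      unfolding p q using dm_cross_pos[of \<rho> d x y] dm_cross_pos[of \<rho> d y x]
      by (cases i; cases j) auto
    show "dm_comp_fun \<rho> d p r \<le> dm_comp_fun \<rho> d p q + dm_comp_fun \<rho> d q r"
      unfolding p q r
      using dist_triangle[of x z y] dm_cross_triangle1[of \<rho> d x z y] dm_cross_triangle2[of \<rho> d x z y]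
        dm_cross_triangle1[of \<rho> d z x y] dm_cross_triangle2[of \<rho> d z x y]
        dm_cross_triangle3[of x z \<rho> d y] dm_cross_triangle4[of x z \<rho> d y]
      by (cases i; cases j; cases k) (simp_all add: dist_commute)
  qed
  moreover have "dm_comp_fun \<rho> d (x, i) (y, i) = dist x y" for x y i
    by (cases i) auto
  ultimately show ?thesis
    using dm_cross_bound[of \<rho> d] by (simp add: double_metrics_iff)
qed

lift_definition dm_comp :: "'a::metric_space double_metric \<Rightarrow> 'a double_metric \<Rightarrow> 'a double_metric"
  is dm_comp_fun
  by (rule dm_comp_fun_in_double_metrics)

lemma dm_comp_eq:
  "dmetric (dm_comp \<rho> d) (x, False) (z, True)
    = (INF y. dmetric d (x, False) (y, True) + dmetric \<rho> (y, False) (z, True))"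
  by (simp add: dm_comp.rep_eq dm_cross_def)

lemma dm_comp_cross: "dmetric (dm_comp \<rho> d) (x, False) (z, True) = dm_cross \<rho> d x z"
  by (simp add: dm_comp.rep_eq)

lemma double_metric_eqI:
  assumes "\<And>x y. dmetric d (x, False) (y, True) = dmetric e (x, False) (y, True)"
  shows "d = e"
proof -
  have "dmetric d (x, i) (y, j) = dmetric e (x, i) (y, j)" for x y i j
    using assms[of x y] assms[of y x] dmetric_commute[of d "(x, True)"] dmetric_commute[of e "(x, True)"]
    by (cases i; cases j) auto
  then have "dmetric d = dmetric e" by (auto simp: fun_eq_iff)
  then show ?thesis by (simp add: dmetric_inject)
qed

lemma dm_comp_assoc: "dm_comp (dm_comp \<sigma> \<rho>) d = dm_comp \<sigma> (dm_comp \<rho> d)"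
proof (rule double_metric_eqI)
  fix x z
  have "dm_cross (dm_comp \<sigma> \<rho>) d x z \<le> dm_cross \<sigma> (dm_comp \<rho> d) x z"
  proof (rule dm_cross_greatest)
    fix w
    have "dm_cross (dm_comp \<sigma> \<rho>) d x z - dmetric \<sigma> (w, False) (z, True) \<le> dm_cross \<rho> d x w"
    proof (rule dm_cross_greatest)
      fix y
      show "dm_cross (dm_comp \<sigma> \<rho>) d x z - dmetric \<sigma> (w, False) (z, True)
          \<le> dmetric d (x, False) (y, True) + dmetric \<rho> (y, False) (w, True)"
        using dm_cross_le[of "dm_comp \<sigma> \<rho>" d x z y] dm_cross_le[of \<sigma> \<rho> y z w]
        by (simp add: dm_comp_cross)
    qed
    then show "dm_cross (dm_comp \<sigma> \<rho>) d x z
        \<le> dmetric (dm_comp \<rho> d) (x, False) (w, True) + dmetric \<sigma> (w, False) (z, True)"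
      by (simp add: dm_comp_cross)
  qed
  moreover have "dm_cross \<sigma> (dm_comp \<rho> d) x z \<le> dm_cross (dm_comp \<sigma> \<rho>) d x z"
  proof (rule dm_cross_greatest)
    fix y
    have "dm_cross \<sigma> (dm_comp \<rho> d) x z - dmetric d (x, False) (y, True) \<le> dm_cross \<sigma> \<rho> y z"
    proof (rule dm_cross_greatest)
      fix w
      show "dm_cross \<sigma> (dm_comp \<rho> d) x z - dmetric d (x, False) (y, True)
          \<le> dmetric \<rho> (y, False) (w, True) + dmetric \<sigma> (w, False) (z, True)"
        using dm_cross_le[of \<sigma> "dm_comp \<rho> d" x z w] dm_cross_le[of \<rho> d x w y]
        by (simp add: dm_comp_cross)
    qed
    then show "dm_cross \<sigma> (dm_comp \<rho> d) x z
        \<le> dmetric d (x, False) (y, True) + dmetric (dm_comp \<sigma> \<rho>) (y, False) (z, True)"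
      by (simp add: dm_comp_cross)
  qed
  ultimately show "dmetric (dm_comp (dm_comp \<sigma> \<rho>) d) (x, False) (z, True)
      = dmetric (dm_comp \<sigma> (dm_comp \<rho> d)) (x, False) (z, True)"
    by (simp add: dm_comp_cross)
qed

lemma dm_dominated_comp:
  assumes "dm_dominated \<rho>1 \<rho>2" "dm_dominated d1 d2"
  shows "dm_dominated (dm_comp \<rho>1 d1) (dm_comp \<rho>2 d2)"
proof -
  obtain \<alpha> \<beta> \<alpha>' \<beta>' where ab: "\<alpha> > 0" "\<beta> \<ge> 1" "\<alpha>' > 0" "\<beta>' \<ge> 1"
    and *: "\<And>x y. dmetric \<rho>1 (x, False) (y, True) \<le> \<alpha> + \<beta> * dmetric \<rho>2 (x, False) (y, True)"
      "\<And>x y. dmetric d1 (x, False) (y, True) \<le> \<alpha>' + \<beta>' * dmetric d2 (x, False) (y, True)"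
    using assms unfolding dm_dominated_def by metis
  define A where "A = \<alpha> + \<alpha>'"
  define B where "B = max \<beta> \<beta>'"
  have AB: "A > 0" "B \<ge> 1" using ab by (auto simp: A_def B_def)
  have "dm_cross \<rho>1 d1 x z \<le> A + B * dm_cross \<rho>2 d2 x z" for x z
  proof -
    have "(dm_cross \<rho>1 d1 x z - A) / B \<le> dm_cross \<rho>2 d2 x z"
    proof (rule dm_cross_greatest)
      fix y
      have "dm_cross \<rho>1 d1 x z \<le> A + B * (dmetric d2 (x, False) (y, True) + dmetric \<rho>2 (y, False) (z, True))"
        using dm_cross_le[of \<rho>1 d1 x z y] *(1)[of y z] *(2)[of x y]
          mult_right_mono[of \<beta> B "dmetric \<rho>2 (y, False) (z, True)"]
          mult_right_mono[of \<beta>' B "dmetric d2 (x, False) (y, True)"]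
        by (simp add: A_def B_def distrib_left)
      then show "(dm_cross \<rho>1 d1 x z - A) / B
          \<le> dmetric d2 (x, False) (y, True) + dmetric \<rho>2 (y, False) (z, True)"
        using AB by (simp add: field_simps)
    qed
    then show ?thesis using AB by (simp add: field_simps)
  qed
  then show ?thesis
    unfolding dm_dominated_def dm_comp_cross using AB by blast
qed

text \<open>The semigroup $M(X)$ of equivalence classes.\<close>

quotient_type (overloaded) 'a double_class = "'a::metric_space double_metric" / dm_equiv
  morphisms Rep_double_class dclass
  by (rule equivp_dm_equiv)

instantiation double_class :: (metric_space) semigroup_mult
begin

lift_definition times_double_class :: "'a double_class \<Rightarrow> 'a double_class \<Rightarrow> 'a double_class"
  is dm_comp
  by (auto simp: dm_equiv_iff_dominated intro: dm_dominated_comp)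

instance
proof
  show "a * b * c = a * (b * c)" for a b c :: "'a double_class"
    by transfer (simp add: dm_comp_assoc dm_equiv_iff_dominated dm_dominated_refl)
qed

end

lemma dclass_mult: "dclass \<rho> * dclass d = dclass (dm_comp \<rho> d)"
  by (rule times_double_class.abs_eq)

lemma dclass_eq_iff: "dclass d1 = dclass d2 \<longleftrightarrow> dm_equiv d1 d2"
  by (rule double_class.abs_eq_iff)

end

theory Submission
  imports Defs
begin

text \<open>
  Idempotency forces $d(x,x') = O(1 + d(x,z'))$ for all $x, z$, so $d$ is controlled by its
  diagonal: whenever $d(x,z')$ is small, $x$ is close to $z$ and $d(x,x')$ is small.
  For idempotent $d$ and $\rho$, the intermediate point $y$ of an almost optimal path for
  $\rho d(x,z')$ therefore serves equally well for $d\rho(x,z')$.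
\<close>

text \<open>For every \<open>y\<close>, moving from \<open>x'\<close> to \<open>y'\<close> costs
  \<open>dist x y\<close>, at most \<open>d(x,z') + d(y,z')\<close>. So a cheap path through
  \<open>y\<close> makes \<open>d(x,x')\<close> small, and the hypothesis bounds the infimum over
  such paths by \<open>d(x,z')\<close>.\<close>

lemma idempotent_diagonal_bound:
  assumes "dm_dominated (dm_comp d d) d"
  obtains K where "\<And>x z. dmetric d (x, False) (x, True) \<le> K * (1 + dmetric d (x, False) (z, True))"
proof -
  obtain \<alpha> \<beta> where ab: "\<alpha> > 0" "\<beta> \<ge> 1"
    and dom: "\<And>x z. dm_cross d d x z \<le> \<alpha> + \<beta> * dmetric d (x, False) (z, True)"
    using assms unfolding dm_dominated_def dm_comp_cross by blast
  have "dmetric d (x, False) (x, True)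
      \<le> (2 * \<alpha> + 2 * \<beta> + 1) * (1 + dmetric d (x, False) (z, True))" for x z
  proof -
    let ?s = "dmetric d (x, False) (z, True)"
    \<comment> \<open>Solved for the infimum, so that it suffices to bound each candidate
      \<open>y\<close>.\<close>
    have "(dmetric d (x, False) (x, True) - ?s) / 2 \<le> dm_cross d d x z"
    proof (rule dm_cross_greatest)
      fix y
      have "dist x y \<le> ?s + dmetric d (y, False) (z, True)"
        using dmetric_triangle[of d "(x, False)" "(y, False)" "(z, True)"]
        by (simp add: dmetric_commute[of d "(z, True)"])
      moreover have "dmetric d (x, False) (x, True) \<le> dmetric d (x, False) (y, True) + dist x y"
        using dmetric_triangle[of d "(x, False)" "(x, True)" "(y, True)"]
        by (simp add: dist_commute)
      ultimately have "dmetric d (x, False) (x, True) - ?s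
          \<le> 2 * dmetric d (x, False) (y, True) + 2 * dmetric d (y, False) (z, True)"
        using dmetric_nonneg[of d "(x, False)" "(y, True)"]
          dmetric_nonneg[of d "(y, False)" "(z, True)"] by linarith
      then show "(dmetric d (x, False) (x, True) - ?s) / 2
          \<le> dmetric d (x, False) (y, True) + dmetric d (y, False) (z, True)"
        by simp
    qed
    with dom[of x z] have "dmetric d (x, False) (x, True) \<le> 2 * \<alpha> + (2 * \<beta> + 1) * ?s"
      by (simp add: algebra_simps)
    \<comment> \<open>The mixed term that appears when the product bound is expanded;
      \<open>linarith\<close> treats it as an atom.\<close>
    moreover have "0 \<le> \<alpha> * ?s" using ab by simp
    ultimately show ?thesis
      using ab unfolding distrib_left distrib_right mult.assoc mult_1_left mult_1_right by linarith
  qed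
  then show thesis by (rule that)
qed

text \<open>One half of commutativity; the hypotheses are symmetric in \<open>d\<close> and
  \<open>\<rho>\<close>, so exchanging them gives the other half.\<close>

lemma idempotents_comp_dominated:
  assumes "dm_dominated (dm_comp d d) d" and "dm_dominated (dm_comp \<rho> \<rho>) \<rho>"
  shows "dm_dominated (dm_comp d \<rho>) (dm_comp \<rho> d)"
proof -
  obtain K1 where K1: "\<And>x z. dmetric d (x, False) (x, True)
      \<le> K1 * (1 + dmetric d (x, False) (z, True))"
    using idempotent_diagonal_bound[OF assms(1)] by blast
  obtain K2 where K2: "\<And>x z. dmetric \<rho> (x, False) (x, True)
      \<le> K2 * (1 + dmetric \<rho> (x, False) (z, True))"
    using idempotent_diagonal_bound[OF assms(2)] by blast
  \<comment> \<open>The 1 guarantees a positive additive constant \<open>4 * K\<close> and a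
    positive divisor \<open>2 * K + 3\<close>.\<close>
  define K where "K = max 1 (max K1 K2)"
  have K: "K \<ge> 1" "K \<ge> K1" "K \<ge> K2" by (auto simp: K_def)
  have "dm_cross d \<rho> x z \<le> 4 * K + (2 * K + 3) * dm_cross \<rho> d x z" for x z
  proof -
    have "(dm_cross d \<rho> x z - 4 * K) / (2 * K + 3) \<le> dm_cross \<rho> d x z"
    proof (rule dm_cross_greatest)
      fix y
      let ?s = "dmetric d (x, False) (y, True)" and ?t = "dmetric \<rho> (y, False) (z, True)"
      have diag_d: "dmetric d (x, False) (x, True) \<le> K * (1 + ?s)"
        using K1[of x y] mult_right_mono[of K1 K "1 + ?s"] by (simp add: K add_nonneg_nonneg)
      have diag_\<rho>: "dmetric \<rho> (y, False) (y, True) \<le> K * (1 + ?t)"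
        using K2[of y z] mult_right_mono[of K2 K "1 + ?t"] by (simp add: K add_nonneg_nonneg)
      have xy: "dist x y \<le> K * (1 + ?s) + ?s"
        using dmetric_triangle[of d "(x, True)" "(y, True)" "(x, False)"] diag_d
        by (simp add: dmetric_commute[of d "(x, True)"])
      have yz: "dist y z \<le> K * (1 + ?t) + ?t"
        using dmetric_triangle[of \<rho> "(y, True)" "(z, True)" "(y, False)"] diag_\<rho>
        by (simp add: dmetric_commute[of \<rho> "(y, True)"])
      \<comment> \<open>The same \<open>y\<close> now serves the composite in the other order:
        \<open>x\<close> to \<open>y'\<close> by \<open>\<rho>\<close>, then \<open>y\<close> to
        \<open>z'\<close> by \<open>d\<close>.\<close>
      have "dmetric \<rho> (x, False) (y, True) \<le> dist x y + dmetric \<rho> (y, False) (y, True)"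
        using dmetric_triangle[of \<rho> "(x, False)" "(y, True)" "(y, False)"] by simp
      moreover have "dmetric d (y, False) (z, True) \<le> dist x y + ?s + dist y z"
        using dmetric_triangle[of d "(y, False)" "(z, True)" "(x, False)"]
          dmetric_triangle[of d "(x, False)" "(z, True)" "(y, True)"]
        by (simp add: dist_commute)
      \<comment> \<open>The estimates add up to
        \<open>4 * K + (2 * K + 3) * ?s + (2 * K + 1) * ?t\<close>; this evens out the two
        coefficients.\<close>
      moreover have "0 \<le> ?t" by simp
      ultimately have "dm_cross d \<rho> x z \<le> 4 * K + (2 * K + 3) * (?s + ?t)"
        using dm_cross_le[of d \<rho> x z y] diag_\<rho> xy yz
        unfolding distrib_left distrib_right mult.assoc mult_1_right by linarith
      then show "(dm_cross d \<rho> x z - 4 * K) / (2 * K + 3) \<le> ?s + ?t"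
        using K by (simp add: field_simps)
    qed
    then show ?thesis using K by (simp add: field_simps)
  qed
  moreover have "4 * K > 0" "2 * K + 3 \<ge> 1" using K by auto
  ultimately show ?thesis
    unfolding dm_dominated_def dm_comp_cross by blast
qed

theorem corollary5p2:
  fixes a b :: "'a::metric_space double_class"
  assumes "a * a = a" and "b * b = b"
  shows "a * b = b * a"
  using assms
  \<comment> \<open>Equivalence is domination both ways, so the lemma is applied twice with the
    roles exchanged.\<close>
  by transfer (auto simp: dm_equiv_iff_dominated intro: idempotents_comp_dominated)

end
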